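(* Let $Q=\langle x_{1},\ldots ,x_n\mid r_{1},\ldots ,r_m\rangle$ be a finite presentation with cyclically reduced relators of exponent sum $0$. Assume that $W^+(Q)$ or $W^-(Q)$ is a forest. Then $Q$ is DR directed away from $\{ x_k\}$ for each generator $x_k$.
   Context: For a presentation $Q=\langle x_1,\ldots ,x_n\mid r_1,\ldots ,r_m\rangle$, $K(Q)$ is the 2-complex with one vertex, one oriented edge for each generator, and one 2-cell for each relator, attached along the relator word. The Whitehead graph $W(Q)$ is the boundary of a regular neighborhood of the only vertex of $K(Q)$. It is a non-oriented (multi)graph with vertices $x_i^+,x_i^-$, $i=1,\ldots,n$, where $x_i^+$ is a point of the oriented edge $x_i$ close to its beginning and $x_i^-$ a point close to its ending; its edges are the corners of the 2-cells: each pair of cyclically consecutive letters $x_i^{\epsilon}x_j^{\delta}$ of a relator gives an edge joining $x_i^{-}$ (if $\epsilon=1$) or $x_i^+$ (if $\epsilon=-1$) to $x_j^+$ (if $\delta=1$) or $x_j^-$ (if $\delta=-1$). $W^+(Q)$ is the full subgraph on the vertices $x_i^+$ and $W^-(Q)$ the full subgraph on the vertices $x_i^-$. The exponent sum of a relator is the sum of the exponents $\pm1$ of all its letters. A spherical diagram over $K(Q)$ is a map $f\colon C\to K(Q)$, with $C$ a 2-sphere with cell structure, that maps open cells homeomorphically to open cells; the label of an edge of $C$ is the generator it maps to. A folding edge of $C$ is an edge $e$ such that the two 2-cells of $C$ containing $e$ in their boundary map to the same 2-cell of $K(Q)$ with opposite orientations by folding over $e$ (mirror images across $e$, so $e$ corresponds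 to the same letter position of the relator in both). For a proper subset $S$ of the generators, $Q$ is DR directed away from $S$ if every spherical diagram that contains an edge with label not from $S$ also contains a folding edge with label not from $S$. *)

theory Defs
  imports "HOL-Combinatorics.Permutations" "HOL-Combinatorics.Orbits"
begin

section \<open>Presentations\<close>

text \<open>The letter \<open>(x, True)\<close> stands for \<open>x\<close>, and \<open>(x, False)\<close> for the inverse of \<open>x\<close>.\<close>

type_synonym 'g letter = "'g \<times> bool"

type_synonym 'g word = "'g letter list"

definition inv_letter :: "'g letter \<Rightarrow> 'g letter" where
  "inv_letter a = (fst a, \<not> snd a)"

definition exponent_sum :: "'g word \<Rightarrow> int" where
  "exponent_sum w = (\<Sum>a\<leftarrow>w. if snd a then 1 else - 1)"

definition cyclically_reduced :: "'g word \<Rightarrow> bool" where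
  "cyclically_reduced w \<longleftrightarrow>
     (\<forall>i < length w. w ! (Suc i mod length w) \<noteq> inv_letter (w ! i))"

text \<open>Relators form a list, since repeated relators give distinct 2-cells.\<close>

record 'g presentation =
  generators :: "'g set"
  relators :: "'g word list"

definition finite_presentation :: "'g presentation \<Rightarrow> bool" where
  "finite_presentation Q \<longleftrightarrow>
     finite (generators Q) \<and> (\<forall>r \<in> set (relators Q). fst ` set r \<subseteq> generators Q)"


section \<open>Multigraphs and forests\<close>

text \<open>An edge \<open>e\<close> has the set \<open>mg_ends G e\<close> of end points, a singleton if \<open>e\<close> is a loop.\<close>

record ('v, 'e) multigraph =
  mg_verts :: "'v set"
  mg_edges :: "'e set"
  mg_ends :: "'e \<Rightarrow> 'v set"

definition full_subgraph :: "('v, 'e) multigraph \<Rightarrow> 'v set \<Rightarrow> ('v, 'e) multigraph" where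
  "full_subgraph G A =
     \<lparr>mg_verts = mg_verts G \<inter> A,
      mg_edges = {e \<in> mg_edges G. mg_ends G e \<subseteq> A},
      mg_ends = mg_ends G\<rparr>"

text \<open>Loops are cycles of length 1, and pairs of parallel edges are cycles of length 2.\<close>

definition is_cycle :: "('v, 'e) multigraph \<Rightarrow> 'v list \<Rightarrow> 'e list \<Rightarrow> bool" where
  "is_cycle G vs es \<longleftrightarrow>
     es \<noteq> [] \<and> length vs = length es \<and> distinct vs \<and> distinct es \<and>
     set vs \<subseteq> mg_verts G \<and> set es \<subseteq> mg_edges G \<and>
     (\<forall>i < length es. mg_ends G (es ! i) = {vs ! i, vs ! (Suc i mod length es)})"

definition forest :: "('v, 'e) multigraph \<Rightarrow> bool" where
  "forest G \<longleftrightarrow> \<not> (\<exists>vs es. is_cycle G vs es)"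


section \<open>The Whitehead graph\<close>

text \<open>The vertex \<open>(x, True)\<close> is the point \<open>x\<^sup>+\<close> near the beginning of the edge \<open>x\<close>, and
  \<open>(x, False)\<close> is the point \<open>x\<^sup>-\<close> near its end.  The edge \<open>(j, i)\<close> is the corner of the
  \<open>j\<close>-th 2-cell between the letters at positions \<open>i\<close> and \<open>i + 1\<close> (cyclically): one leaves the
  letter at \<open>i\<close> through its final point, hence the negated sign, and enters the next one
  through its initial point.\<close>

definition whitehead_graph :: "'g presentation \<Rightarrow> ('g \<times> bool, nat \<times> nat) multigraph" where
  "whitehead_graph Q =
     \<lparr>mg_verts = generators Q \<times> UNIV,
      mg_edges = {(j, i). j < length (relators Q) \<and> i < length (relators Q ! j)},
      mg_ends = (\<lambda>(j, i). let r = relators Q ! j; a = r ! i; b = r ! (Suc i mod length r)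
                 in {(fst a, \<not> snd a), (fst b, snd b)})\<rparr>"

definition whitehead_plus :: "'g presentation \<Rightarrow> ('g \<times> bool, nat \<times> nat) multigraph" where
  "whitehead_plus Q = full_subgraph (whitehead_graph Q) {v. snd v}"

definition whitehead_minus :: "'g presentation \<Rightarrow> ('g \<times> bool, nat \<times> nat) multigraph" where
  "whitehead_minus Q = full_subgraph (whitehead_graph Q) {v. \<not> snd v}"


section \<open>Cell structures on the 2-sphere\<close>

text \<open>A cell structure with at least one edge is encoded as a combinatorial map.  A dart is an
  edge with one of its two directions; \<open>opp d\<close> is the reversed dart, and \<open>nxt d\<close> is the dart
  after \<open>d\<close> on the boundary of the 2-cell to the left of \<open>d\<close> (for a fixed orientation of the
  sphere), so it starts where \<open>d\<close> ends.  Hence the 2-cells are the orbits of \<open>nxt\<close>, the edges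
  those of \<open>opp\<close>, and the vertices those of \<open>nxt \<circ> opp\<close>, which permutes the darts starting at a
  vertex.  The closed surface so described is a sphere iff it is connected of Euler
  characteristic 2.  Since cell structures on a compact surface are finite, darts can be taken
  to be natural numbers.  The only cell structure left out is that with no edges.\<close>

record cell_structure =
  darts :: "nat set"
  opp :: "nat \<Rightarrow> nat"
  nxt :: "nat \<Rightarrow> nat"

definition vertices_of :: "'z cell_structure_scheme \<Rightarrow> nat set set" where
  "vertices_of C = orbit (nxt C \<circ> opp C) ` darts C"

definition edges_of :: "'z cell_structure_scheme \<Rightarrow> nat set set" where
  "edges_of C = orbit (opp C) ` darts C"

definition faces_of :: "'z cell_structure_scheme \<Rightarrow> nat set set" where
  "faces_of C = orbit (nxt C) ` darts C"

definition closed_surface :: "'z cell_structure_scheme \<Rightarrow> bool" where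
  "closed_surface C \<longleftrightarrow>
     finite (darts C) \<and> opp C permutes darts C \<and> nxt C permutes darts C \<and>
     (\<forall>d \<in> darts C. opp C d \<noteq> d \<and> opp C (opp C d) = d)"

definition connected_surface :: "'z cell_structure_scheme \<Rightarrow> bool" where
  "connected_surface C \<longleftrightarrow>
     (\<forall>d \<in> darts C. \<forall>d' \<in> darts C.
        (d, d') \<in> ({(e, opp C e) | e. e \<in> darts C} \<union> {(e, nxt C e) | e. e \<in> darts C})\<^sup>*)"

definition euler_characteristic :: "'z cell_structure_scheme \<Rightarrow> int" where
  "euler_characteristic C =
     int (card (vertices_of C)) - int (card (edges_of C)) + int (card (faces_of C))"

definition is_sphere :: "'z cell_structure_scheme \<Rightarrow> bool" where
  "is_sphere C \<longleftrightarrow> closed_surface C \<and> connected_surface C \<and> euler_characteristic C = 2"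


section \<open>Spherical diagrams\<close>

text \<open>The map to \<open>K(Q)\<close> is recorded dart by dart: the 2-cell to the left of \<open>d\<close> is mapped to
  the 2-cell of the relator number \<open>cell d\<close>, with orientation preserved iff \<open>orient d\<close>, and the
  side \<open>d\<close> of it goes to the letter at position \<open>pos d\<close> of that relator.  If the orientation is
  reversed, then the boundary of the 2-cell reads the relator backwards and inverted.\<close>

record diagram = cell_structure +
  cell :: "nat \<Rightarrow> nat"
  pos :: "nat \<Rightarrow> nat"
  orient :: "nat \<Rightarrow> bool"

definition dart_letter :: "'g presentation \<Rightarrow> diagram \<Rightarrow> nat \<Rightarrow> 'g letter" where
  "dart_letter Q C d =
     (let a = relators Q ! cell C d ! pos C d in if orient C d then a else inv_letter a)"

definition edge_label :: "'g presentation \<Rightarrow> diagram \<Rightarrow> nat \<Rightarrow> 'g" where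
  "edge_label Q C d = fst (dart_letter Q C d)"

text \<open>The condition on the size of \<open>orbit (nxt C) d\<close> says that a 2-cell is attached along its
  relator exactly once, so that the map is injective on its interior.\<close>

definition spherical_diagram :: "'g presentation \<Rightarrow> diagram \<Rightarrow> bool" where
  "spherical_diagram Q C \<longleftrightarrow>
     is_sphere C \<and>
     (\<forall>d \<in> darts C.
        cell C d < length (relators Q) \<and>
        (let r = relators Q ! cell C d; d' = nxt C d in
           pos C d < length r \<and>
           card (orbit (nxt C) d) = length r \<and>
           cell C d' = cell C d \<and>
           orient C d' = orient C d \<and>
           (if orient C d then pos C d' = Suc (pos C d) mod length r
            else pos C d = Suc (pos C d') mod length r)) \<and>
        dart_letter Q C (opp C d) = inv_letter (dart_letter Q C d))"

text \<open>The edge of \<open>d\<close> is a folding edge if the 2-cells on its two sides are mirror images of each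
  other across it.\<close>

definition folding_edge :: "diagram \<Rightarrow> nat \<Rightarrow> bool" where
  "folding_edge C d \<longleftrightarrow>
     cell C (opp C d) = cell C d \<and>
     pos C (opp C d) = pos C d \<and>
     orient C (opp C d) \<noteq> orient C d"

text \<open>The notion is meant for proper subsets \<open>S\<close> of the generators; for \<open>S = generators Q\<close> it holds
  vacuously.\<close>

definition DR_directed_away_from :: "'g presentation \<Rightarrow> 'g set \<Rightarrow> bool" where
  "DR_directed_away_from Q S \<longleftrightarrow>
     (\<forall>C. spherical_diagram Q C \<and> (\<exists>d \<in> darts C. edge_label Q C d \<notin> S) \<longrightarrow>
        (\<exists>d \<in> darts C. folding_edge C d \<and> edge_label Q C d \<notin> S))"

end

theory Submission
  imports Defs
begin

text \<open>Orient every edge of a spherical diagram as its label prescribes.  Since all relators have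
  exponent sum \<open>0\<close>, counting the edges of a path with their signs gives \<open>0\<close> around every 2-cell,
  and the first cohomology of the sphere vanishes; so the vertices carry a height function that
  rises by \<open>1\<close> along every edge.  All edges at a vertex of minimal height leave it.  The corners
  around this vertex then form a closed walk in \<open>W\<^sup>+(Q)\<close>; likewise a vertex of maximal height
  gives a closed walk in \<open>W\<^sup>-(Q)\<close>.  Reversing the height treats both cases at once, with a sign
  \<open>b\<close> in place of \<open>+\<close> or \<open>-\<close>.

  In a forest, the subgraph traversed by a closed walk of positive length has at least two
  leaves, and the walk turns back at each of them.  So it turns back at a vertex with label
  different from any given \<open>x\<close> (\<open>forest_closed_walk_turns\<close>).  Turning back means that the
  two corners on the two sides of an edge of the diagram are the same corner of \<open>K(Q)\<close>.  As the
  relators are cyclically reduced, the two 2-cells have opposite orientations, and the edge is a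
  folding edge (\<open>equal_corners_fold\<close>).

  The topological input, \<open>sphere_cocycle_is_coboundary\<close>, is obtained from the Euler
  characteristic by counting.  A spanning tree \<open>T\<close> of the dual graph has \<open>F - 1\<close> edges, and a
  cocycle that vanishes off \<open>T\<close> vanishes: peel off the leaves of \<open>T\<close>.  Hence the
  edges off \<open>T\<close> connect all vertices, because otherwise the coboundary of the indicator function
  of a union of components would be a nonzero cocycle vanishing on them.  There are
  \<open>E - F + 1 = V - 1\<close> of these edges, so they form a spanning tree, along which any cocycle can
  be integrated.  The coboundary of the resulting function agrees with the cocycle off \<open>T\<close>, hence
  everywhere.\<close>

section \<open>Orbits on a closed surface\<close>

definition origin :: "'z cell_structure_scheme \<Rightarrow> nat \<Rightarrow> nat set" where
  "origin C d = orbit (nxt C \<circ> opp C) d"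

definition left_face :: "'z cell_structure_scheme \<Rightarrow> nat \<Rightarrow> nat set" where
  "left_face C d = orbit (nxt C) d"

lemma closed_surfaceD:
  assumes "closed_surface C"
  shows "finite (darts C)"
    and "d \<in> darts C \<Longrightarrow> opp C d \<in> darts C"
    and "d \<in> darts C \<Longrightarrow> nxt C d \<in> darts C"
    and "d \<in> darts C \<Longrightarrow> opp C d \<noteq> d"
    and "d \<in> darts C \<Longrightarrow> opp C (opp C d) = d"
    and "permutation (nxt C)"
    and "permutation (nxt C \<circ> opp C)"
proof -
  have fin: "finite (darts C)" and o: "opp C permutes darts C" and n: "nxt C permutes darts C"
    using assms by (auto simp: closed_surface_def)
  show "finite (darts C)" by (fact fin)
  show "d \<in> darts C \<Longrightarrow> opp C d \<in> darts C" using o by (simp add: permutes_in_image)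
  show "d \<in> darts C \<Longrightarrow> nxt C d \<in> darts C" using n by (simp add: permutes_in_image)
  show "d \<in> darts C \<Longrightarrow> opp C d \<noteq> d" "d \<in> darts C \<Longrightarrow> opp C (opp C d) = d"
    using assms by (auto simp: closed_surface_def)
  show "permutation (nxt C)" "permutation (nxt C \<circ> opp C)"
    using permutes_imp_permutation[OF fin] n permutes_compose[OF o n] by blast+
qed

lemma origin_nxt:
  assumes "closed_surface C" "d \<in> darts C"
  shows "origin C (nxt C d) = origin C (opp C d)"
  using permutation_orbit_step[OF closed_surfaceD(7)[OF assms(1)], of "opp C d"]
  by (simp add: origin_def closed_surfaceD(5)[OF assms])

lemma left_face_nxt:
  assumes "closed_surface C"
  shows "left_face C (nxt C d) = left_face C d"
  by (simp add: left_face_def permutation_orbit_step[OF closed_surfaceD(6)[OF assms]])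

lemma left_face_eqI:
  assumes "closed_surface C" "e \<in> left_face C d"
  shows "left_face C e = left_face C d"
  using assms(2) orbit_cyclic_eq3[OF cyclic_on_orbit'[OF closed_surfaceD(6)[OF assms(1)]]]
  by (simp add: left_face_def)

lemma self_in_left_face:
  assumes "closed_surface C"
  shows "d \<in> left_face C d"
  by (simp add: left_face_def permutation_self_in_orbit[OF closed_surfaceD(6)[OF assms]])

lemma left_face_subset:
  assumes "closed_surface C" "d \<in> darts C"
  shows "left_face C d \<subseteq> darts C"
  using permutes_orbit_subset[of "nxt C" "darts C" d] assms
  by (simp add: left_face_def closed_surface_def)

lemma origin_subset:
  assumes "closed_surface C" "d \<in> darts C"
  shows "origin C d \<subseteq> darts C"
proof -
  have "(nxt C \<circ> opp C) permutes darts C"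
    using assms(1) by (auto simp: closed_surface_def intro: permutes_compose)
  then show ?thesis using permutes_orbit_subset assms(2) by (simp add: origin_def)
qed

lemma finite_left_face:
  assumes "closed_surface C" "d \<in> darts C"
  shows "finite (left_face C d)"
  using left_face_subset[OF assms] closed_surfaceD(1)[OF assms(1)] finite_subset by blast

lemma bij_nxt_left_face:
  assumes "closed_surface C" "d \<in> darts C"
  shows "bij_betw (nxt C) (left_face C d) (left_face C d)"
proof -
  have "nxt C ` left_face C d \<subseteq> left_face C d"
    by (auto simp: left_face_def intro: orbit.step)
  moreover have "nxt C permutes darts C"
    using assms(1) by (simp add: closed_surface_def)
  then have "inj_on (nxt C) (left_face C d)"
    by (rule permutes_inj_on)
  ultimately show ?thesis
    using endo_inj_surj[OF finite_left_face[OF assms]] by (simp add: bij_betw_def)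
qed

lemma sum_left_face_nxt:
  fixes f :: "nat \<Rightarrow> int"
  assumes "closed_surface C" "d \<in> darts C"
  shows "(\<Sum>e\<in>left_face C d. f (nxt C e)) = (\<Sum>e\<in>left_face C d. f e)"
  by (rule sum.reindex_bij_betw[OF bij_nxt_left_face[OF assms]])

lemma card_edges:
  assumes "closed_surface C"
  shows "2 * card (edges_of C) = card (darts C)"
proof -
  note cs = closed_surfaceD[OF assms]
  have orb: "orbit (opp C) d = {d, opp C d}" if d: "d \<in> darts C" for d
  proof
    show "orbit (opp C) d \<subseteq> {d, opp C d}"
    proof
      fix e assume "e \<in> orbit (opp C) d"
      then show "e \<in> {d, opp C d}" by induction (auto simp: cs(5)[OF d])
    qed
    show "{d, opp C d} \<subseteq> orbit (opp C) d"
      using orbit.base[of "opp C" d] orbit.step[OF orbit.base[of "opp C" d]] cs(5)[OF d] by auto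
  qed
  have un: "\<Union> (edges_of C) = darts C"
    using orb cs(2) by (auto simp: edges_of_def)
  have "2 * card (edges_of C) = card (\<Union> (edges_of C))"
  proof (rule card_partition)
    show "finite (edges_of C)" by (simp add: edges_of_def cs(1))
    show "finite (\<Union> (edges_of C))" using un cs(1) by simp
    show "card c = 2" if "c \<in> edges_of C" for c
      using that orb cs(4) by (fastforce simp: edges_of_def)
    show "c1 \<inter> c2 = {}" if "c1 \<in> edges_of C" "c2 \<in> edges_of C" "c1 \<noteq> c2" for c1 c2
    proof -
      from that obtain a b where "a \<in> darts C" "b \<in> darts C" "c1 = {a, opp C a}" "c2 = {b, opp C b}"
        using orb by (auto simp: edges_of_def)
      then show ?thesis using that(3) cs(5)[of a] cs(5)[of b] by auto
    qed
  qed
  then show ?thesis by (simp add: un)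
qed

text \<open>The form in which connectedness enters.  It is applied with \<open>q\<close> the vertex at the origin of a
  dart, to grow a tree, and with \<open>q\<close> the 2-cell on its left, to grow a tree in the dual graph;
  the hypothesis on \<open>q\<close> covers both.\<close>

lemma crossing_dart:
  assumes "closed_surface C" "connected_surface C"
    and q: "\<And>d. d \<in> darts C \<Longrightarrow> q (nxt C d) = q d \<or> q (nxt C d) = q (opp C d)"
    and X: "X \<subset> q ` darts C" "X \<noteq> {}"
  obtains d where "d \<in> darts C" "q d \<in> X" "q (opp C d) \<notin> X"
proof -
  note cs = closed_surfaceD[OF assms(1)]
  obtain a where a: "a \<in> darts C" "q a \<in> X" using X by blast
  obtain b where b: "b \<in> darts C" "q b \<notin> X" using X by blast
  have "\<exists>d \<in> darts C. q d \<in> X \<and> q (opp C d) \<notin> X"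
  proof (rule ccontr)
    assume no: "\<not> ?thesis"
    have "(a, b) \<in> ({(e, opp C e) | e. e \<in> darts C} \<union> {(e, nxt C e) | e. e \<in> darts C})\<^sup>*"
      using assms(2) a b by (auto simp: connected_surface_def)
    then have "b \<in> darts C \<and> q b \<in> X"
    proof induction
      case base
      show ?case using a by simp
    next
      case (step y z)
      have "q (opp C y) \<in> X" using no step.IH by blast
      then show ?case using step cs(2,3) q[of y] by auto
    qed
    with b show False by simp
  qed
  then show ?thesis using that by blast
qed

section \<open>The sphere has no first cohomology\<close>

text \<open>1-cochains are antisymmetric functions on darts.  In the notation of this encoding, the end of
  a dart \<open>d\<close> is \<open>origin C (opp C d)\<close>.\<close>

definition cocycle :: "'z cell_structure_scheme \<Rightarrow> (nat \<Rightarrow> int) \<Rightarrow> bool" where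
  "cocycle C s \<longleftrightarrow>
     (\<forall>d \<in> darts C. s (opp C d) = - s d) \<and> (\<forall>d \<in> darts C. sum s (left_face C d) = 0)"

text \<open>The sum over the boundary of a 2-cell telescopes, as \<open>nxt\<close> permutes its darts.\<close>

lemma coboundary_is_cocycle:
  assumes "closed_surface C"
  shows "cocycle C (\<lambda>d. h (origin C (opp C d)) - h (origin C d))"
  unfolding cocycle_def
proof (intro conjI ballI)
  note cs = closed_surfaceD[OF assms]
  fix d assume d: "d \<in> darts C"
  show "h (origin C (opp C (opp C d))) - h (origin C (opp C d)) =
      - (h (origin C (opp C d)) - h (origin C d))"
    by (simp add: cs(5)[OF d])
  have "(\<Sum>e\<in>left_face C d. h (origin C (opp C e)) - h (origin C e)) =
      (\<Sum>e\<in>left_face C d. h (origin C (nxt C e)) - h (origin C e))"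
    using left_face_subset[OF assms d] origin_nxt[OF assms] by (intro sum.cong) auto
  also have "\<dots> = 0"
    using sum_left_face_nxt[OF assms d, of "\<lambda>e. h (origin C e)"] by (simp add: sum_subtractf)
  finally show "(\<Sum>e\<in>left_face C d. h (origin C (opp C e)) - h (origin C e)) = 0" .
qed

definition determines_cocycles :: "'z cell_structure_scheme \<Rightarrow> nat set \<Rightarrow> bool" where
  "determines_cocycles C R \<longleftrightarrow>
     (\<forall>s. cocycle C s \<longrightarrow> (\<forall>d \<in> R. s d = 0) \<longrightarrow> (\<forall>d \<in> darts C. s d = 0))"

text \<open>The tree is grown by one 2-cell at a time.  When the 2-cell \<open>f\<close> is joined to the tree by an
  edge, that edge is the only one of the new tree that lies on \<open>f\<close>, and only one of its sides
  does.  So for a cochain supported on the new tree, the sum around \<open>f\<close> is its value on this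
  edge; being \<open>0\<close>, it leaves a cochain supported on the old tree.  The set \<open>T\<close> contains both
  darts of each edge of the tree, hence the factors \<open>2\<close> in the cardinalities.\<close>

lemma dual_spanning_tree:
  assumes cs0: "closed_surface C" and conn: "connected_surface C" and ne: "darts C \<noteq> {}"
  obtains T where "T \<subseteq> darts C" "opp C ` T \<subseteq> T" "card T + 2 = 2 * card (faces_of C)"
    "determines_cocycles C (darts C - T)"
proof -
  note cs = closed_surfaceD[OF cs0]
  have faces: "faces_of C = left_face C ` darts C" by (simp add: faces_of_def left_face_def)
  define good where "good Y T \<longleftrightarrow> T \<subseteq> darts C \<and> opp C ` T \<subseteq> T \<and> left_face C ` T \<subseteq> Y \<and>
      (\<forall>s::nat \<Rightarrow> int. (\<forall>d\<in>darts C. s (opp C d) = - s d) \<longrightarrow> (\<forall>d\<in>darts C - T. s d = 0) \<longrightarrow>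
        (\<forall>d\<in>darts C. left_face C d \<in> Y \<longrightarrow> sum s (left_face C d) = 0) \<longrightarrow>
        (\<forall>d\<in>darts C. s d = 0))" for Y T
  have grow: "\<exists>Y T. Y \<subseteq> faces_of C \<and> card Y = Suc n \<and> card T = 2 * n \<and> good Y T"
    if "Suc n \<le> card (faces_of C)" for n
    using that
  proof (induction n)
    case 0
    from ne obtain d where "d \<in> darts C" by blast
    then have "{left_face C d} \<subseteq> faces_of C" by (simp add: faces)
    moreover have "good {left_face C d} {}" by (simp add: good_def)
    ultimately show ?case by (intro exI[of _ "{left_face C d}"] exI[of _ "{}"]) simp
  next
    case (Suc n)
    then obtain Y T where Y: "Y \<subseteq> faces_of C" "card Y = Suc n" and T: "card T = 2 * n" "good Y T"
      by auto
    have fT: "finite T" using T(2) cs(1) finite_subset by (auto simp: good_def)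
    have fY: "finite Y" using Y(2) card.infinite by fastforce
    have "Y \<noteq> {}" using Y(2) by auto
    have "Y \<noteq> faces_of C" using Y(2) Suc.prems by auto
    then have Ys: "Y \<subset> left_face C ` darts C" using Y(1) faces by blast
    obtain d where d: "d \<in> darts C" "left_face C d \<in> Y" "left_face C (opp C d) \<notin> Y"
      using crossing_dart[OF cs0 conn _ Ys \<open>Y \<noteq> {}\<close>] left_face_nxt[OF cs0] by auto
    let ?d = "opp C d" and ?f = "left_face C (opp C d)"
    let ?T = "insert d (insert ?d T)"
    have dd: "?d \<in> darts C" "opp C ?d = d" "?d \<noteq> d" using cs d(1) by auto
    have nT: "?d \<notin> T" "d \<notin> T" using T(2) d(3) by (auto simp: good_def)
    have "good (insert ?f Y) ?T"
      unfolding good_def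
    proof (intro conjI allI impI)
      show "?T \<subseteq> darts C" "opp C ` ?T \<subseteq> ?T" "left_face C ` ?T \<subseteq> insert ?f Y"
        using T(2) d dd by (auto simp: good_def)
    next
      fix s :: "nat \<Rightarrow> int"
      assume anti: "\<forall>d\<in>darts C. s (opp C d) = - s d" and zero: "\<forall>d\<in>darts C - ?T. s d = 0"
        and sums: "\<forall>d\<in>darts C. left_face C d \<in> insert ?f Y \<longrightarrow> sum s (left_face C d) = 0"
      have "sum s ?f = s ?d + sum s (?f - {?d})"
        using self_in_left_face[OF cs0] finite_left_face[OF cs0 dd(1)] by (simp add: sum.remove)
      also have "sum s (?f - {?d}) = 0"
      proof (rule sum.neutral, rule ballI)
        fix e assume e: "e \<in> ?f - {?d}"
        then have "left_face C e = ?f" using left_face_eqI[OF cs0] by blast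
        then have "e \<notin> ?T" using e d T(2) by (auto simp: good_def)
        then show "s e = 0" using zero left_face_subset[OF cs0 dd(1)] e by blast
      qed
      finally have "s ?d = 0" using sums dd(1) by simp
      then have "\<forall>e\<in>darts C - T. s e = 0" using zero anti d(1) by auto
      moreover have "\<forall>d\<in>darts C. left_face C d \<in> Y \<longrightarrow> sum s (left_face C d) = 0"
        using sums by simp
      ultimately show "\<forall>d\<in>darts C. s d = 0" using T(2) anti by (simp add: good_def)
    qed
    moreover have "card ?T = 2 * Suc n" using nT dd(3) fT T(1) by simp
    moreover have "card (insert ?f Y) = Suc (Suc n)" using d(3) fY Y(2) by simp
    moreover have "insert ?f Y \<subseteq> faces_of C" using Y(1) dd(1) by (simp add: faces)
    ultimately show ?case by blast
  qed
  have fin: "finite (faces_of C)" by (simp add: faces cs(1))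
  then have pos: "card (faces_of C) > 0" using ne by (simp add: card_gt_0_iff faces)
  then obtain Y T where Y: "Y \<subseteq> faces_of C" "card Y = card (faces_of C)"
    and T: "card T = 2 * (card (faces_of C) - 1)" "good Y T"
    using grow[of "card (faces_of C) - 1"] by auto
  show ?thesis
  proof (rule that)
    show "T \<subseteq> darts C" "opp C ` T \<subseteq> T" using T(2) by (auto simp: good_def)
    show "card T + 2 = 2 * card (faces_of C)" using T(1) pos by simp
    show "determines_cocycles C (darts C - T)"
      using T(2) by (simp add: good_def determines_cocycles_def cocycle_def)
  qed
qed

text \<open>The edges in \<open>R\<close> connect all vertices: for a proper nonempty set \<open>X\<close> of vertices, the
  coboundary \<open>z\<close> of its indicator function is a nonzero cocycle, hence nonzero on some edge in
  \<open>R\<close>, which leaves \<open>X\<close>.  So a tree with edges in \<open>R\<close> can be grown, and the potential \<open>h\<close>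
  is extended to each new vertex by the value of \<open>s\<close> on the edge that reaches it.\<close>

lemma primal_spanning_tree:
  fixes s :: "nat \<Rightarrow> int"
  assumes cs0: "closed_surface C" and conn: "connected_surface C" and ne: "darts C \<noteq> {}"
    and R: "R \<subseteq> darts C" "opp C ` R \<subseteq> R"
    and det: "determines_cocycles C R"
    and anti: "\<And>d. d \<in> darts C \<Longrightarrow> s (opp C d) = - s d"
  obtains T h where "T \<subseteq> R" "card T + 2 = 2 * card (vertices_of C)"
    "\<And>d. d \<in> T \<Longrightarrow> h (origin C (opp C d)) = h (origin C d) + s d"
proof -
  note cs = closed_surfaceD[OF cs0]
  have verts: "vertices_of C = origin C ` darts C" by (simp add: vertices_of_def origin_def)
  define good where "good X T h \<longleftrightarrow> T \<subseteq> R \<and> opp C ` T \<subseteq> T \<and> origin C ` T \<subseteq> X \<and>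
      (\<forall>d\<in>T. h (origin C (opp C d)) = h (origin C d) + s d)" for X T and h :: "nat set \<Rightarrow> int"
  have grow: "\<exists>X T h. X \<subseteq> vertices_of C \<and> card X = Suc n \<and> card T = 2 * n \<and> good X T h"
    if "Suc n \<le> card (vertices_of C)" for n
    using that
  proof (induction n)
    case 0
    from ne obtain d where "d \<in> darts C" by blast
    then have "{origin C d} \<subseteq> vertices_of C" by (simp add: verts)
    moreover have "good {origin C d} {} (\<lambda>_. 0)" by (simp add: good_def)
    ultimately show ?case by (intro exI[of _ "{origin C d}"] exI[of _ "{}"] exI[of _ "\<lambda>_. 0"]) simp
  next
    case (Suc n)
    then obtain X T h where X: "X \<subseteq> vertices_of C" "card X = Suc n"
      and T: "card T = 2 * n" "good X T h"
      by auto
    have fT: "finite T" using T(2) R cs(1) finite_subset by (metis good_def)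
    have fX: "finite X" using X(2) card.infinite by fastforce
    have "X \<noteq> {}" using X(2) by auto
    have "X \<noteq> vertices_of C" using X(2) Suc.prems by auto
    then have Xs: "X \<subset> origin C ` darts C" using X(1) verts by blast
    define z :: "nat \<Rightarrow> int" where
      "z d = of_bool (origin C (opp C d) \<in> X) - of_bool (origin C d \<in> X)" for d
    have "cocycle C z"
      using coboundary_is_cocycle[OF cs0, of "\<lambda>v. of_bool (v \<in> X)"] by (simp add: z_def[abs_def])
    obtain a where a: "a \<in> darts C" "origin C a \<in> X" "origin C (opp C a) \<notin> X"
      using crossing_dart[OF cs0 conn _ Xs \<open>X \<noteq> {}\<close>] origin_nxt[OF cs0] by auto
    then have "z a \<noteq> 0" by (simp add: z_def)
    then obtain b where b: "b \<in> R" "z b \<noteq> 0" using det \<open>cocycle C z\<close> a(1)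
      unfolding determines_cocycles_def by blast
    define d where "d = (if origin C b \<in> X then b else opp C b)"
    have d: "d \<in> R" "origin C d \<in> X" "origin C (opp C d) \<notin> X"
      using b R cs(5)[of b] by (auto simp: d_def z_def of_bool_def split: if_splits)
    let ?d = "opp C d" and ?v = "origin C (opp C d)"
    let ?T = "insert d (insert ?d T)" and ?h = "h(?v := h (origin C d) + s d)"
    have dD: "d \<in> darts C" using d(1) R by blast
    have dd: "?d \<in> R" "opp C ?d = d" "?d \<noteq> d" "s ?d = - s d" using cs d(1) R dD anti by auto
    have vd: "?v \<noteq> origin C d" using d by metis
    have nT: "?d \<notin> T" "d \<notin> T" using T(2) d(3) by (auto simp: good_def)
    have "good (insert ?v X) ?T ?h"
      unfolding good_def
    proof (intro conjI ballI)
      show "?T \<subseteq> R" "opp C ` ?T \<subseteq> ?T" "origin C ` ?T \<subseteq> insert ?v X"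
        using T(2) d dd by (auto simp: good_def)
    next
      fix e assume "e \<in> ?T"
      then consider "e = d" | "e = ?d" | "e \<in> T" by blast
      then show "?h (origin C (opp C e)) = ?h (origin C e) + s e"
      proof cases
        case 1
        then show ?thesis using vd by simp
      next
        case 2
        then show ?thesis using vd dd by simp
      next
        case 3
        then have "origin C e \<in> X" "origin C (opp C e) \<in> X" using T(2)
          unfolding good_def by blast+
        then have "origin C e \<noteq> ?v" "origin C (opp C e) \<noteq> ?v" using d(3) by auto
        then show ?thesis using 3 T(2) by (simp add: good_def)
      qed
    qed
    moreover have "card ?T = 2 * Suc n" using nT dd(3) fT T(1) by simp
    moreover have "card (insert ?v X) = Suc (Suc n)" using d(3) fX X(2) by simp
    moreover have "insert ?v X \<subseteq> vertices_of C" using X(1) dd(1) R by (auto simp: verts)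
    ultimately show ?case by blast
  qed
  have "finite (vertices_of C)" by (simp add: verts cs(1))
  then have pos: "card (vertices_of C) > 0" using ne by (simp add: card_gt_0_iff verts)
  then obtain X T h where "card T = 2 * (card (vertices_of C) - 1)" "good X T h"
    using grow[of "card (vertices_of C) - 1"] by auto
  then show ?thesis using that[of T h] pos by (auto simp: good_def)
qed

lemma sphere_cocycle_is_coboundary:
  assumes "is_sphere C" "cocycle C s"
  obtains h :: "nat set \<Rightarrow> int"
  where "\<And>d. d \<in> darts C \<Longrightarrow> h (origin C (opp C d)) = h (origin C d) + s d"
proof (cases "darts C = {}")
  case True
  then show ?thesis using that by simp
next
  case False
  have cs0: "closed_surface C" and conn: "connected_surface C"
    and chi: "euler_characteristic C = 2"
    using assms(1) by (auto simp: is_sphere_def)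
  note cs = closed_surfaceD[OF cs0]
  obtain T where T: "T \<subseteq> darts C" "opp C ` T \<subseteq> T" "card T + 2 = 2 * card (faces_of C)"
    and det: "determines_cocycles C (darts C - T)"
    using dual_spanning_tree[OF cs0 conn False] by blast
  let ?R = "darts C - T"
  have "opp C ` ?R \<subseteq> ?R"
  proof
    fix e assume "e \<in> opp C ` ?R"
    then obtain d where "d \<in> ?R" "e = opp C d" by blast
    then show "e \<in> ?R" using T(2) cs(2,5)[of d] by force
  qed
  moreover have "\<And>d. d \<in> darts C \<Longrightarrow> s (opp C d) = - s d"
    using assms(2) by (simp add: cocycle_def)
  ultimately obtain U h where U: "U \<subseteq> ?R" "card U + 2 = 2 * card (vertices_of C)"
    and h: "\<And>d. d \<in> U \<Longrightarrow> h (origin C (opp C d)) = h (origin C d) + s d"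
    using primal_spanning_tree[OF cs0 conn False _ _ det, of s] by blast
  have fR: "finite ?R" using cs(1) by simp
  have "card ?R = card (darts C) - card T"
    using T(1) cs(1) by (simp add: card_Diff_subset finite_subset)
  moreover have "card T \<le> card (darts C)" using T(1) cs(1) by (simp add: card_mono)
  \<comment> \<open>These count darts, two for each edge: \<open>2 (V - 1)\<close> in \<open>U\<close>, and \<open>2 E - 2 (F - 1)\<close> off \<open>T\<close>.\<close>
  ultimately have "card U = card ?R"
    using U(2) T(3) chi card_edges[OF cs0] by (simp add: euler_characteristic_def)
  then have UR: "U = ?R" using U(1) fR by (simp add: card_subset_eq)
  let ?z = "\<lambda>d. s d - (h (origin C (opp C d)) - h (origin C d))"
  have "cocycle C ?z"
    using assms(2) coboundary_is_cocycle[OF cs0, of h] by (auto simp: cocycle_def sum_subtractf)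
  moreover have "?z d = 0" if "d \<in> ?R" for d using h that UR by simp
  ultimately have "?z d = 0" if "d \<in> darts C" for d
    using det that unfolding determines_cocycles_def by blast
  then show ?thesis using that[of h] by (simp add: algebra_simps)
qed

text \<open>A potential of \<open>s\<close> attains its minimum at such a vertex.\<close>

lemma sphere_has_source:
  fixes s :: "nat \<Rightarrow> int"
  assumes "is_sphere C" "cocycle C s" "darts C \<noteq> {}"
    and nz: "\<And>d. d \<in> darts C \<Longrightarrow> s d \<noteq> 0"
  obtains d where "d \<in> darts C" "\<And>e. e \<in> origin C d \<Longrightarrow> s e > 0"
proof -
  have cs0: "closed_surface C" using assms(1) by (simp add: is_sphere_def)
  note cs = closed_surfaceD[OF cs0]
  obtain h :: "nat set \<Rightarrow> int"
    where h: "\<And>d. d \<in> darts C \<Longrightarrow> h (origin C (opp C d)) = h (origin C d) + s d"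
    using sphere_cocycle_is_coboundary[OF assms(1,2)] by blast
  obtain d where d: "d \<in> darts C" "\<And>e. e \<in> darts C \<Longrightarrow> h (origin C d) \<le> h (origin C e)"
    using ex_min_if_finite[of "(\<lambda>d. h (origin C d)) ` darts C"] cs(1) assms(3)
    by (auto simp: not_less)
  show ?thesis
  proof (rule that[OF d(1)])
    fix e assume e: "e \<in> origin C d"
    then have eD: "e \<in> darts C" using origin_subset[OF cs0 d(1)] by blast
    have "origin C e = origin C d"
      using e orbit_cyclic_eq3[OF cyclic_on_orbit'[OF cs(7)]] by (simp add: origin_def)
    then have "s e \<ge> 0" using d(2)[OF cs(2)[OF eD]] h[OF eD] by simp
    then show "s e > 0" using nz[OF eD] by simp
  qed
qed

section \<open>Closed walks in forests\<close>

text \<open>The excluded vertex \<open>k\<close> may itself be a turning point, so the walk is cut at its visits to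
  \<open>k\<close>: a walk without other turning points has a closed stretch from \<open>i\<close> to \<open>i + m\<close> whose
  interior avoids \<open>k\<close> and therefore has no turning points at all.  A shortest such stretch
  traverses a cycle: its vertices are distinct by minimality, and an edge traversed twice would
  have to be traversed back and forth in immediate succession.\<close>

lemma forest_closed_walk_turns:
  fixes w :: "nat \<Rightarrow> 'v" and e :: "nat \<Rightarrow> 'e"
  assumes "forest G"
    and verts: "\<And>i. w i \<in> mg_verts G" and edges: "\<And>i. e i \<in> mg_edges G"
    and ends: "\<And>i. mg_ends G (e i) = {w i, w (Suc i)}"
    and n: "n > 0" and period: "\<And>i. w (i + n) = w i"
  obtains i where "e i = e (Suc i)" "w (Suc i) \<noteq> k"
proof -
  have "\<exists>i. e i = e (Suc i) \<and> w (Suc i) \<noteq> k"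
  proof (rule ccontr)
    assume "\<not> ?thesis"
    then have turn: "e i \<noteq> e (Suc i)" if "w (Suc i) \<noteq> k" for i using that by metis
    define P where "P i m \<longleftrightarrow> m > 0 \<and> w i = w (i + m) \<and> (\<forall>l. i < l \<and> l < i + m \<longrightarrow> w l \<noteq> k)" for i m
    have "\<exists>m i. P i m"
    proof (cases "\<exists>i. w i = k")
      case False
      then have "P 0 n" using n period[of 0] by (simp add: P_def)
      then show ?thesis by blast
    next
      case True
      then obtain i where i: "w i = k" by blast
      define m where "m = (LEAST m. m > 0 \<and> w (i + m) = k)"
      have "n > 0 \<and> w (i + n) = k" using n period i by simp
      then have m: "m > 0 \<and> w (i + m) = k" unfolding m_def by (rule LeastI)
      have "w l \<noteq> k" if "i < l" "l < i + m" for l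
        using not_less_Least[of "l - i" "\<lambda>m. m > 0 \<and> w (i + m) = k"] that
        by (auto simp: m_def[symmetric])
      then have "P i m" using m i by (simp add: P_def)
      then show ?thesis by blast
    qed
    define m where "m = (LEAST m. \<exists>i. P i m)"
    from \<open>\<exists>m i. P i m\<close> have "\<exists>i. P i m" unfolding m_def by (rule LeastI_ex)
    then obtain i where P: "P i m" by blast
    have min: "m \<le> m'" if "P i' m'" for i' m' using that unfolding m_def by (auto intro: Least_le)
    have dist: "w a \<noteq> w b" if "i \<le> a" "a < b" "b < i + m" for a b
    proof
      assume "w a = w b"
      then have "P a (b - a)" using that P by (auto simp: P_def)
      from min[OF this] show False using that by simp
    qed
    have edist: "e a \<noteq> e b" if "i \<le> a" "a < b" "b < i + m" for a b
    proof
      assume eq: "e a = e b"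
      then have "{w a, w (Suc a)} = {w b, w (Suc b)}" using ends by metis
      with dist[OF that] have "w (Suc a) = w b" by (auto simp: doubleton_eq_iff)
      with dist[of "Suc a" b] that have "Suc a = b" by (cases "Suc a < b") auto
      moreover have "w b \<noteq> k" using P that by (auto simp: P_def)
      ultimately show False using turn[of a] eq by simp
    qed
    have "is_cycle G (map w [i..<i+m]) (map e [i..<i+m])"
      unfolding is_cycle_def
    proof (intro conjI allI impI)
      show "map e [i..<i+m] \<noteq> []" using P by (simp add: P_def)
      show "length (map w [i..<i+m]) = length (map e [i..<i+m])" by simp
      have "inj_on w {i..<i+m}" "inj_on e {i..<i+m}"
        by (rule linorder_inj_onI'; use dist edist in simp)+
      then show "distinct (map w [i..<i+m])" "distinct (map e [i..<i+m])"
        by (auto simp: distinct_map)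
      show "set (map w [i..<i+m]) \<subseteq> mg_verts G" "set (map e [i..<i+m]) \<subseteq> mg_edges G"
        using verts edges by auto
      fix l assume "l < length (map e [i..<i+m])"
      then have l: "l < m" by simp
      show "mg_ends G (map e [i..<i+m] ! l) =
          {map w [i..<i+m] ! l, map w [i..<i+m] ! (Suc l mod length (map e [i..<i+m]))}"
      proof (cases "Suc l = m")
        case True
        have "w (Suc (i + l)) = w i" using P True by (auto simp: P_def)
        then show ?thesis using l True ends[of "i + l"] by simp
      next
        case False
        then show ?thesis using l ends[of "i + l"] by simp
      qed
    qed
    with assms(1) show False by (auto simp: forest_def)
  qed
  then show ?thesis using that by blast
qed

section \<open>Spherical diagrams\<close>

lemma spherical_diagramD:
  assumes "spherical_diagram Q C"
  shows "is_sphere C" and "closed_surface C"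
    and "d \<in> darts C \<Longrightarrow> cell C d < length (relators Q)"
    and "d \<in> darts C \<Longrightarrow> pos C d < length (relators Q ! cell C d)"
    and "d \<in> darts C \<Longrightarrow> card (left_face C d) = length (relators Q ! cell C d)"
    and "d \<in> darts C \<Longrightarrow> cell C (nxt C d) = cell C d"
    and "d \<in> darts C \<Longrightarrow> orient C (nxt C d) = orient C d"
    and "d \<in> darts C \<Longrightarrow> orient C d \<Longrightarrow>
      pos C (nxt C d) = Suc (pos C d) mod length (relators Q ! cell C d)"
    and "d \<in> darts C \<Longrightarrow> \<not> orient C d \<Longrightarrow>
      pos C d = Suc (pos C (nxt C d)) mod length (relators Q ! cell C d)"
    and "d \<in> darts C \<Longrightarrow> dart_letter Q C (opp C d) = inv_letter (dart_letter Q C d)"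
proof -
  let ?r = "relators Q ! cell C d"
  show "is_sphere C" using assms by (simp add: spherical_diagram_def)
  then show "closed_surface C" by (simp add: is_sphere_def)
  assume "d \<in> darts C"
  then have *: "cell C d < length (relators Q) \<and> pos C d < length ?r \<and>
      card (left_face C d) = length ?r \<and> cell C (nxt C d) = cell C d \<and>
      orient C (nxt C d) = orient C d \<and>
      (if orient C d then pos C (nxt C d) = Suc (pos C d) mod length ?r
       else pos C d = Suc (pos C (nxt C d)) mod length ?r) \<and>
      dart_letter Q C (opp C d) = inv_letter (dart_letter Q C d)"
    using assms unfolding spherical_diagram_def Let_def left_face_def by blast
  then show "cell C d < length (relators Q)" "pos C d < length ?r"
    "card (left_face C d) = length ?r" "cell C (nxt C d) = cell C d"
    "orient C (nxt C d) = orient C d"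
    "dart_letter Q C (opp C d) = inv_letter (dart_letter Q C d)"
    by blast+
  show "orient C d \<Longrightarrow> pos C (nxt C d) = Suc (pos C d) mod length ?r"
    "\<not> orient C d \<Longrightarrow> pos C d = Suc (pos C (nxt C d)) mod length ?r"
    using * by (simp_all only: if_True if_False)
qed

lemma inv_letter_simps [simp]:
  "inv_letter (inv_letter a) = a" "fst (inv_letter a) = fst a" "snd (inv_letter a) \<longleftrightarrow> \<not> snd a"
  by (simp_all add: inv_letter_def)

lemma relator_letter:
  "relators Q ! cell C d ! pos C d =
     (if orient C d then dart_letter Q C d else inv_letter (dart_letter Q C d))"
  by (simp add: dart_letter_def)

lemma cyclic_Suc_closed:
  assumes "a \<in> P" "a < n" and step: "\<And>i. i \<in> P \<Longrightarrow> i < n \<Longrightarrow> Suc i mod n \<in> P"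
  shows "{..<n} \<subseteq> P"
proof -
  have all: "(a + m) mod n \<in> P" for m
  proof (induction m)
    case 0
    then show ?case using assms by simp
  next
    case (Suc m)
    then show ?case using step[of "(a + m) mod n"] assms(2) by (simp add: mod_Suc_eq)
  qed
  show ?thesis
  proof
    fix i assume "i \<in> {..<n}"
    then show "i \<in> P" using all[of "n - a + i"] assms(2) by simp
  qed
qed

text \<open>Along the boundary of a 2-cell the position moves by one step in a constant direction, so all
  positions occur; as the boundary has the length of the relator, each occurs once.\<close>

lemma left_face_relator:
  assumes Q: "spherical_diagram Q C" and d: "d \<in> darts C"
  shows "\<And>e. e \<in> left_face C d \<Longrightarrow> cell C e = cell C d \<and> orient C e = orient C d"
    and "bij_betw (pos C) (left_face C d) {..<length (relators Q ! cell C d)}"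
proof -
  note sd = spherical_diagramD[OF Q]
  let ?n = "length (relators Q ! cell C d)" and ?F = "left_face C d"
  have sub: "?F \<subseteq> darts C" using left_face_subset[OF sd(2) d] .
  show const: "cell C e = cell C d \<and> orient C e = orient C d" if "e \<in> ?F" for e
  proof -
    from that have "e \<in> orbit (nxt C) d" by (simp add: left_face_def)
    then show ?thesis
    proof induction
      case base
      then show ?case using sd(6,7)[OF d] by simp
    next
      case (step e)
      then have "e \<in> darts C" using sub by (auto simp: left_face_def)
      then show ?case using step sd(6,7)[of e] by simp
    qed
  qed
  have fin: "finite ?F" using finite_left_face[OF sd(2) d] .
  have img: "pos C ` ?F \<subseteq> {..<?n}"
  proof
    fix i assume "i \<in> pos C ` ?F"
    then obtain e where "e \<in> ?F" "i = pos C e" by blast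
    then show "i \<in> {..<?n}" using const[of e] sd(4)[of e] sub by auto
  qed
  have dF: "d \<in> ?F" using self_in_left_face[OF sd(2)] .
  have "{..<?n} \<subseteq> pos C ` ?F"
  proof (rule cyclic_Suc_closed)
    show "pos C d \<in> pos C ` ?F" "pos C d < ?n" using dF sd(4)[OF d] by auto
    fix i assume "i \<in> pos C ` ?F"
    then obtain e where e: "e \<in> ?F" "i = pos C e" by blast
    have eD: "e \<in> darts C" using e sub by blast
    show "Suc i mod ?n \<in> pos C ` ?F"
    proof (cases "orient C e")
      case True
      then have "Suc i mod ?n = pos C (nxt C e)" using sd(8)[OF eD] const[OF e(1)] e(2) by simp
      moreover have "nxt C e \<in> ?F" using e(1) by (auto simp: left_face_def intro: orbit.step)
      ultimately show ?thesis by blast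
    next
      case False
      have "e \<in> nxt C ` ?F"
        using bij_nxt_left_face[OF sd(2) d] e(1) by (simp add: bij_betw_def)
      then obtain f where f: "f \<in> ?F" "e = nxt C f" by blast
      have fD: "f \<in> darts C" using f sub by blast
      have "pos C f = Suc i mod ?n"
        using sd(9)[OF fD] False const[OF f(1)] const[OF e(1)] f(2) e(2) by simp
      then show ?thesis using f(1) by (metis imageI)
    qed
  qed
  with img have eq: "pos C ` ?F = {..<?n}" by blast
  moreover have "inj_on (pos C) ?F"
    using sd(5)[OF d] eq fin by (intro eq_card_imp_inj_on) auto
  ultimately show "bij_betw (pos C) ?F {..<?n}" by (simp add: bij_betw_def)
qed

text \<open>For \<open>b = True\<close> this is the sign with which a dart follows the orientation of its edge; for
  \<open>b = False\<close> all signs are changed, so that sinks become sources.\<close>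

definition direction :: "'g presentation \<Rightarrow> diagram \<Rightarrow> bool \<Rightarrow> nat \<Rightarrow> int" where
  "direction Q C b d = (if snd (dart_letter Q C d) = b then 1 else - 1)"

lemma direction_cocycle:
  assumes Q: "spherical_diagram Q C" and exps: "\<forall>r \<in> set (relators Q). exponent_sum r = 0"
  shows "cocycle C (direction Q C b)"
  unfolding cocycle_def
proof (intro conjI ballI)
  note sd = spherical_diagramD[OF Q]
  fix d assume d: "d \<in> darts C"
  show "direction Q C b (opp C d) = - direction Q C b d"
    by (simp add: direction_def sd(10)[OF d])
  let ?r = "relators Q ! cell C d"
  let ?c = "if orient C d = b then 1 else - 1 :: int"
  have "(\<Sum>e\<in>left_face C d. direction Q C b e) =
      (\<Sum>e\<in>left_face C d. ?c * (if snd (?r ! pos C e) then 1 else - 1))"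
  proof (rule sum.cong)
    fix e assume "e \<in> left_face C d"
    then have "cell C e = cell C d" "orient C e = orient C d"
      using left_face_relator(1)[OF Q d] by auto
    then show "direction Q C b e = ?c * (if snd (?r ! pos C e) then 1 else - 1)"
      using relator_letter[of Q C e] by (auto simp: direction_def)
  qed simp
  also have "\<dots> = (\<Sum>i<length ?r. ?c * (if snd (?r ! i) then 1 else - 1))"
    by (rule sum.reindex_bij_betw[OF left_face_relator(2)[OF Q d]])
  also have "\<dots> = ?c * exponent_sum ?r"
    by (simp add: exponent_sum_def sum_list_sum_nth atLeast0LessThan sum_distrib_left)
  also have "\<dots> = 0" using exps sd(3)[OF d] by simp
  finally show "(\<Sum>e\<in>left_face C d. direction Q C b e) = 0" .
qed

text \<open>The edge of the Whitehead graph given by the corner, at the end of \<open>d\<close>, of the 2-cell to the left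
  of \<open>d\<close>, that is, between \<open>d\<close> and \<open>nxt C d\<close>.  If the orientation is reversed, the relator
  visits \<open>nxt C d\<close> first.\<close>

definition corner :: "diagram \<Rightarrow> nat \<Rightarrow> nat \<times> nat" where
  "corner C d = (cell C d, if orient C d then pos C d else pos C (nxt C d))"

text \<open>The corner joins the points of the Whitehead graph that belong to the two darts leaving the
  vertex there; the point of a dart leaving the vertex is encoded like its letter.\<close>

lemma corner_in_whitehead_graph:
  assumes Q: "spherical_diagram Q C" and d: "d \<in> darts C"
  shows "corner C d \<in> mg_edges (whitehead_graph Q)"
    and "mg_ends (whitehead_graph Q) (corner C d) =
      {dart_letter Q C (opp C d), dart_letter Q C (nxt C d)}"
proof -
  note sd = spherical_diagramD[OF Q]
  have nd: "nxt C d \<in> darts C" using closed_surfaceD(3)[OF sd(2) d] .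
  show "corner C d \<in> mg_edges (whitehead_graph Q)"
    using sd(3,4,6)[OF d] sd(4)[OF nd] by (simp add: corner_def whitehead_graph_def)
  have "relators Q ! cell C d ! pos C (nxt C d) =
     (if orient C d then dart_letter Q C (nxt C d) else inv_letter (dart_letter Q C (nxt C d)))"
    using relator_letter[of Q C "nxt C d"] sd(6,7)[OF d] by simp
  then show "mg_ends (whitehead_graph Q) (corner C d) =
      {dart_letter Q C (opp C d), dart_letter Q C (nxt C d)}"
    using relator_letter[of Q C d] sd(8,9)[OF d] sd(10)[OF d]
    by (cases "orient C d") (auto simp: corner_def whitehead_graph_def Let_def inv_letter_def)
qed

text \<open>The corners \<open>corner C f\<close> and \<open>corner C (opp C (nxt C f))\<close> lie next to each other at the end of
  \<open>f\<close>, on the two sides of the edge of \<open>nxt C f\<close>.  If they are equal and the 2-cells have the same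
  orientation, then the edge is read once before and once after the corner, in opposite
  directions, so two consecutive letters of the relator cancel.\<close>

lemma equal_corners_fold:
  assumes Q: "spherical_diagram Q C" and red: "\<forall>r \<in> set (relators Q). cyclically_reduced r"
    and f: "f \<in> darts C" and eq: "corner C f = corner C (opp C (nxt C f))"
  shows "folding_edge C (nxt C f)"
proof -
  note sd = spherical_diagramD[OF Q]
  note cs = closed_surfaceD[OF sd(2)]
  let ?d = "nxt C f" and ?o = "opp C (nxt C f)"
  let ?r = "relators Q ! cell C f" and ?n = "nxt C (opp C (nxt C f))"
  have dD: "?d \<in> darts C" and oD: "?o \<in> darts C" using cs(2,3) f by auto
  have cd: "cell C ?d = cell C f" "orient C ?d = orient C f" using sd(6,7)[OF f] by auto
  have co: "cell C ?o = cell C f" using eq by (simp add: corner_def)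
  have r: "cyclically_reduced ?r" using red sd(3)[OF f] by simp
  have let_d: "?r ! pos C ?d =
      (if orient C f then dart_letter Q C ?d else inv_letter (dart_letter Q C ?d))"
    using relator_letter[of Q C ?d] cd by simp
  have let_o: "?r ! pos C ?o =
      (if orient C ?o then inv_letter (dart_letter Q C ?d) else dart_letter Q C ?d)"
    using relator_letter[of Q C ?o] co sd(10)[OF dD] by simp
  have no: "?r ! (Suc i mod length ?r) \<noteq> inv_letter (?r ! i)" if "i < length ?r" for i
    using r that by (simp add: cyclically_reduced_def)
  consider "orient C f" "orient C ?o" | "\<not> orient C f" "\<not> orient C ?o"
    | "orient C f" "\<not> orient C ?o" | "\<not> orient C f" "orient C ?o" by blast
  then show ?thesis
  proof cases
    case 1
    then have "pos C ?o = pos C f" "pos C ?d = Suc (pos C f) mod length ?r"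
      using eq sd(8)[OF f] by (auto simp: corner_def)
    then show ?thesis using no[of "pos C f"] sd(4)[OF f] let_d let_o 1 by simp
  next
    case 2
    then have "pos C ?n = pos C ?d" "pos C ?o = Suc (pos C ?n) mod length ?r"
      using eq sd(9)[OF oD] co by (auto simp: corner_def)
    then show ?thesis using no[of "pos C ?d"] sd(4)[OF dD] let_d let_o cd 2 by simp
  next
    case 3
    then have "pos C ?n = pos C f" "pos C ?d = Suc (pos C f) mod length ?r"
      "pos C ?o = Suc (pos C ?n) mod length ?r"
      using eq sd(8)[OF f] sd(9)[OF oD] co by (auto simp: corner_def)
    then show ?thesis using 3 cd co by (simp add: folding_edge_def)
  next
    case 4
    then have "pos C ?o = pos C ?d" using eq by (simp add: corner_def)
    then show ?thesis using 4 cd co by (simp add: folding_edge_def)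
  qed
qed

text \<open>The closed walk \<open>w\<close> goes around a vertex from which all edges leave (or at which all arrive,
  if \<open>b\<close> is \<open>False\<close>), with the darts \<open>D i\<close> starting at that vertex and the corners \<open>c i\<close> between
  \<open>D i\<close> and \<open>D (Suc i)\<close>.  It turns back at a point other than \<open>(x, b)\<close>, and all its points have
  sign \<open>b\<close>, so the label there is not \<open>x\<close>.\<close>

lemma folding_edge_off_label:
  assumes fin: "finite_presentation Q"
    and red: "\<forall>r \<in> set (relators Q). cyclically_reduced r"
    and exps: "\<forall>r \<in> set (relators Q). exponent_sum r = 0"
    and forest: "forest (full_subgraph (whitehead_graph Q) {v. snd v = b})"
    and C: "spherical_diagram Q C" "darts C \<noteq> {}"
  obtains d where "d \<in> darts C" "folding_edge C d" "edge_label Q C d \<noteq> x"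
proof -
  note sd = spherical_diagramD[OF C(1)]
  note cs = closed_surfaceD[OF sd(2)]
  let ?G = "full_subgraph (whitehead_graph Q) {v. snd v = b}"
  let ?\<sigma> = "nxt C \<circ> opp C"
  have nz: "direction Q C b e \<noteq> 0" for e by (simp add: direction_def)
  obtain d where d: "d \<in> darts C" and out: "\<And>e. e \<in> origin C d \<Longrightarrow> direction Q C b e > 0"
    using sphere_has_source[OF sd(1) direction_cocycle[OF C(1) exps] C(2) nz] by blast
  define D where "D i = (?\<sigma> ^^ i) d" for i
  have dself: "d \<in> origin C d"
    by (simp add: origin_def permutation_self_in_orbit[OF cs(7)])
  then have Dor: "D i \<in> origin C d" for i
    by (simp add: D_def origin_def funpow_in_orbit)
  then have DD: "D i \<in> darts C" for i using origin_subset[OF sd(2) d] by blast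
  have DS: "D (Suc i) = nxt C (opp C (D i))" for i by (simp add: D_def)
  obtain n where n: "n > 0" "(?\<sigma> ^^ n) d = d"
    using dself by (auto simp: origin_def orbit_altdef)
  have period: "D (i + n) = D i" for i using n(2) by (simp add: D_def funpow_add)
  define w where "w i = dart_letter Q C (D i)" for i
  have sw: "snd (w i) = b" for i
    using out[OF Dor[of i]] by (simp add: w_def direction_def split: if_splits)
  define c where "c i = corner C (opp C (D i))" for i
  have oD: "opp C (D i) \<in> darts C" "opp C (opp C (D i)) = D i" for i using DD cs(2,5) by auto
  have ends: "mg_ends (whitehead_graph Q) (c i) = {w i, w (Suc i)}" for i
    using corner_in_whitehead_graph(2)[OF C(1) oD(1)[of i]] by (simp add: c_def w_def DS oD(2))
  have gen: "fst (w i) \<in> generators Q" for i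
  proof -
    have "relators Q ! cell C (D i) ! pos C (D i) \<in> set (relators Q ! cell C (D i))"
      using sd(4)[OF DD] by simp
    then have "fst (relators Q ! cell C (D i) ! pos C (D i)) \<in> generators Q"
      using fin sd(3)[OF DD[of i]] nth_mem unfolding finite_presentation_def by blast
    then show ?thesis by (simp add: w_def dart_letter_def Let_def)
  qed
  obtain i where i: "c i = c (Suc i)" "w (Suc i) \<noteq> (x, b)"
  proof (rule forest_closed_walk_turns[OF forest, of w c n "(x, b)"])
    show "w i \<in> mg_verts ?G" for i
      using gen sw by (simp add: full_subgraph_def whitehead_graph_def mem_Times_iff)
    show "c i \<in> mg_edges ?G" for i
      using corner_in_whitehead_graph(1)[OF C(1) oD(1)[of i]] ends[of i] sw
      by (simp add: full_subgraph_def c_def)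
    show "mg_ends ?G (c i) = {w i, w (Suc i)}" for i
      using ends by (simp add: full_subgraph_def)
    show "n > 0" by (fact n(1))
    show "w (i + n) = w i" for i by (simp add: w_def period)
  qed blast
  show ?thesis
  proof (rule that)
    show "D (Suc i) \<in> darts C" by (fact DD)
    show "folding_edge C (D (Suc i))"
      using equal_corners_fold[OF C(1) red oD(1)[of i]] i(1) by (simp add: c_def DS)
    show "edge_label Q C (D (Suc i)) \<noteq> x"
      using i(2) sw[of "Suc i"] by (auto simp: edge_label_def w_def prod_eq_iff)
  qed
qed

theorem theorem5p3:
  fixes Q :: "'g presentation"
  assumes "finite_presentation Q"
    and "\<forall>r \<in> set (relators Q). cyclically_reduced r"
    and "\<forall>r \<in> set (relators Q). exponent_sum r = 0"
    and "forest (whitehead_plus Q) \<or> forest (whitehead_minus Q)"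
  shows "\<forall>x \<in> generators Q. DR_directed_away_from Q {x}"
proof -
  obtain b where b: "forest (full_subgraph (whitehead_graph Q) {v. snd v = b})"
  proof (cases "forest (whitehead_plus Q)")
    case True
    then show ?thesis using that[of True] by (simp add: whitehead_plus_def)
  next
    case False
    then show ?thesis using that[of False] assms(4) by (simp add: whitehead_minus_def)
  qed
  show ?thesis
    unfolding DR_directed_away_from_def
  proof (intro ballI allI impI)
    fix x C
    assume "spherical_diagram Q C \<and> (\<exists>d \<in> darts C. edge_label Q C d \<notin> {x})"
    then have "spherical_diagram Q C" "darts C \<noteq> {}" by auto
    from folding_edge_off_label[OF assms(1-3) b this, of x]
    show "\<exists>d \<in> darts C. folding_edge C d \<and> edge_label Q C d \<notin> {x}" by auto
  qed
qed

end
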